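(* Fix integers $q\ge2$ and $1\le s\le t$. Let $m$ be a $(q,s)$-insertion-feasible integer. Then, as $n\to\infty$, \[ \max_{\substack{x,y\in\Sigma_q^n\\ |I_s(x)\cap I_s(y)|\le m}} |I_t(x)\cap I_t(y)| = \frac{m(q-1)^{t-s}}{(t-s)!}\,n^{t-s}+O_{q,s,t,m}\!\left(n^{t-s-1}\right). \]
   Context: $\Sigma_q$ is an alphabet of size $q\ge2$, and $\Sigma_q^n$ is the set of sequences of length $n$ over $\Sigma_q$. For sequences $x,w$, write $x\preccurlyeq w$ if $x$ is a (not necessarily contiguous) subsequence of $w$. For $x\in\Sigma_q^n$ and $t\ge0$, the $t$-insertion ball is $I_t(x)=\{w\in\Sigma_q^{n+t}: x\preccurlyeq w\}$. For fixed integers $q\ge2$ and $s\ge1$, a positive integer $m$ is called $(q,s)$-insertion-feasible if there exist an integer $L$ and two sequences $u,v\in\Sigma_q^L$ such that $I_{s-1}(u)\cap I_{s-1}(v)=\varnothing$ and $|I_s(u)\cap I_s(v)|=m$. $O_{q,s,t,m}(f(n))$ denotes a quantity bounded in absolute value by $C f(n)$ for all sufficiently large $n$, where $C$ depends only on $q,s,t,m$. *)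

theory Defs
  imports Complex_Main "HOL-Library.Sublist" "HOL-Library.Landau_Symbols"
begin

definition seqs :: "'a set \<Rightarrow> nat \<Rightarrow> 'a list set" where
  "seqs \<Sigma> n = {w. set w \<subseteq> \<Sigma> \<and> length w = n}"

definition insertion_ball :: "'a set \<Rightarrow> nat \<Rightarrow> 'a list \<Rightarrow> 'a list set" where
  "insertion_ball \<Sigma> t x = {w \<in> seqs \<Sigma> (length x + t). subseq x w}"

text \<open>
  This is \<open>(q, s)\<close>-insertion-feasibility with \<open>q = card \<Sigma>\<close>; up to renaming of letters it
  depends on \<open>\<Sigma>\<close> only through \<open>q\<close>. It is meant for \<open>s \<ge> 1\<close>, where \<open>s - 1\<close> is not truncated.
\<close>

definition insertion_feasible :: "'a set \<Rightarrow> nat \<Rightarrow> nat \<Rightarrow> bool" where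
  "insertion_feasible \<Sigma> s m \<longleftrightarrow>
     m > 0 \<and>
     (\<exists>L. \<exists>u\<in>seqs \<Sigma> L. \<exists>v\<in>seqs \<Sigma> L.
        insertion_ball \<Sigma> (s - 1) u \<inter> insertion_ball \<Sigma> (s - 1) v = {} \<and>
        card (insertion_ball \<Sigma> s u \<inter> insertion_ball \<Sigma> s v) = m)"

end

theory Submission
  imports Defs
begin

text \<open>
  Every common supersequence of \<open>x\<close> and \<open>y\<close> contains one that is produced by merging \<open>x\<close> and
  \<open>y\<close> from the left without wasting letters, and only boundedly many of these have length
  \<open>n + j\<close>. So \<open>I\<^sub>t(x) \<inter> I\<^sub>t(y)\<close> is covered by insertion balls \<open>I\<^sub>t\<^sub>-\<^sub>j(w)\<close> around boundedly many
  words \<open>w\<close> of length \<open>n + j\<close>, each of size of order \<open>n\<^sup>t\<^sup>-\<^sup>j\<close>. When \<open>n \<ge> m\<close> the bound on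
  \<open>|I\<^sub>s(x) \<inter> I\<^sub>s(y)|\<close> excludes \<open>j < s\<close> and leaves at most \<open>m\<close> words for \<open>j = s\<close>, which give the
  leading term. Conversely, prepend a common prefix to the pair witnessing feasibility: the
  \<open>m\<close> words of \<open>I\<^sub>s(x) \<inter> I\<^sub>s(y)\<close> keep their number, and since distinct words of equal
  length have disjoint 0-balls, the covering shows that their \<open>(t - s)\<close>-balls overlap pairwise
  only in lower order.
\<close>

section \<open>Merging two words into common supersequences\<close>

text \<open>Equal heads are always identified; only distinct heads cause a branching. Despite the
  name, members need not be minimal: for \<open>a \<noteq> b\<close>, the words \<open>[a]\<close>
  and \<open>[b, a]\<close> yield \<open>[a, b, a]\<close> besides \<open>[b, a]\<close>. Only
  covering and counting matter below.\<close>

fun min_supseqs :: "'a list \<Rightarrow> 'a list \<Rightarrow> 'a list set" where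
  "min_supseqs [] y = {y}"
| "min_supseqs (a # x) [] = {a # x}"
| "min_supseqs (a # x) (b # y) =
     (if a = b then (#) a ` min_supseqs x y
      else (#) a ` min_supseqs x (b # y) \<union> (#) b ` min_supseqs (a # x) y)"

lemma subseq_min_supseqs:
  "w \<in> min_supseqs x y \<Longrightarrow> subseq x w \<and> subseq y w"
  by (induction x y arbitrary: w rule: min_supseqs.induct) (auto split: if_splits)

lemma set_min_supseqs: "w \<in> min_supseqs x y \<Longrightarrow> set w \<subseteq> set x \<union> set y"
  by (induction x y arbitrary: w rule: min_supseqs.induct) (auto split: if_splits, blast+)

lemma finite_min_supseqs: "finite (min_supseqs x y)"
  by (induction x y rule: min_supseqs.induct) auto

text \<open>Read \<open>w\<close> from the left: a letter heading neither word is skipped, and a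
  letter heading one or both is matched there at once. Such greedy matching loses nothing and
  follows a branch of the recursion.\<close>

lemma common_supseq_contains_min_supseq:
  assumes "subseq x w" "subseq y w"
  shows "\<exists>w0\<in>min_supseqs x y. subseq w0 w"
  using assms
proof (induction w arbitrary: x y rule: list.induct)
  case Nil
  then have "x = []" "y = []" by (auto dest: list_emb_Nil2)
  then show ?case by simp
next
  case (Cons c w)
  show ?case
  proof (cases x)
    case Nil
    then show ?thesis using Cons.prems by auto
  next
    case x: (Cons a x')
    show ?thesis
    proof (cases y)
      case Nil
      then show ?thesis using Cons.prems x by auto
    next
      case y: (Cons b y')
      consider "c \<noteq> a" "c \<noteq> b" | "c = a" "a = b" | "c = a" "a \<noteq> b" | "c = b" "a \<noteq> b"
        by blast
      then show ?thesis
      proof cases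
        case 1
        then have "subseq x w" "subseq y w" using Cons.prems x y by (auto simp: subseq_Cons2_iff)
        then show ?thesis using Cons.IH by blast
      next
        case 2
        then have "subseq x' w" "subseq y' w" using Cons.prems x y by auto
        then show ?thesis using Cons.IH[of x' y'] 2 x y by auto
      next
        case 3
        then have "subseq x' w" "subseq y w" using Cons.prems x y by (auto simp: subseq_Cons2_iff)
        then show ?thesis using Cons.IH[of x' y] 3 x y by auto
      next
        case 4
        then have "subseq x w" "subseq y' w" using Cons.prems x y by (auto simp: subseq_Cons2_iff)
        then show ?thesis using Cons.IH[of x y'] 4 x y by auto
      qed
    qed
  qed
qed

text \<open>Each branching of the recursion uses up one unit of the joint surplus
  \<open>(N - length x) + (N - length y)\<close>.\<close>
lemma card_min_supseqs_le:
  "card {w \<in> min_supseqs x y. length w = N} \<le> 2 ^ (2 * N - length x - length y)"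
proof (induction x y arbitrary: N rule: min_supseqs.induct)
  case (1 y)
  have "{w \<in> min_supseqs [] y. length w = N} \<subseteq> {y}" by auto
  from card_mono[OF _ this] show ?case by (simp add: order.trans[OF _ one_le_power])
next
  case (2 a x)
  have "{w \<in> min_supseqs (a # x) []. length w = N} \<subseteq> {a # x}" by auto
  from card_mono[OF _ this] show ?case by (simp add: order.trans[OF _ one_le_power])
next
  case (3 a x b y)
  show ?case
  proof (cases "length (a # x) \<le> N \<and> length (b # y) \<le> N")
    case False
    then have "{w \<in> min_supseqs (a # x) (b # y). length w = N} = {}"
      by (auto dest!: subseq_min_supseqs list_emb_length simp del: min_supseqs.simps)
    then show ?thesis by (simp only: card.empty)
  next
    case True
    then obtain M where N: "N = Suc M" by (cases N) auto
    let ?S = "\<lambda>x y. {w \<in> min_supseqs x y. length w = M}"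
    show ?thesis
    proof (cases "a = b")
      case eq: True
      have "{w \<in> min_supseqs (a # x) (b # y). length w = N} = (#) a ` ?S x y"
        using eq N by auto
      then have "card {w \<in> min_supseqs (a # x) (b # y). length w = N} = card (?S x y)"
        by (metis (no_types, lifting) card_image inj_onI list.inject)
      then show ?thesis using "3.IH"(1)[OF eq, of M] N by simp
    next
      case ne: False
      \<comment> \<open>With distinct heads, \<open>x\<close> and \<open>y\<close> cannot both have
        the length of \<open>w\<close>, since both would equal \<open>w\<close>. So the exponent is
        positive, and truncated subtraction does not swallow the factor 2 of the branching.\<close>
      have slack: "length x + length y < 2 * M"
        if "w \<in> min_supseqs (a # x) (b # y)" "length w = N" for w
      proof (rule ccontr)
        assume "\<not> length x + length y < 2 * M"
        then have "length (a # x) = length w" "length (b # y) = length w"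
          using True N that(2) by auto
        then have "a # x = w" "b # y = w"
          using subseq_min_supseqs[OF that(1)] subseq_same_length by blast+
        then show False using ne by blast
      qed
      show ?thesis
      proof (cases "length x + length y < 2 * M")
        case False
        then have "{w \<in> min_supseqs (a # x) (b # y). length w = N} = {}" using slack by blast
        then show ?thesis by (simp only: card.empty)
      next
        case True
        have "{w \<in> min_supseqs (a # x) (b # y). length w = N}
            = (#) a ` ?S x (b # y) \<union> (#) b ` ?S (a # x) y"
          using ne N by auto
        then have "card {w \<in> min_supseqs (a # x) (b # y). length w = N}
            \<le> card ((#) a ` ?S x (b # y)) + card ((#) b ` ?S (a # x) y)"
          by (metis (no_types, lifting) card_Un_le)
        also have "\<dots> = card (?S x (b # y)) + card (?S (a # x) y)"
          by (simp add: card_image)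
        also have "\<dots> \<le> 2 ^ (2 * M - length x - length (b # y)) + 2 ^ (2 * M - length (a # x) - length y)"
          by (intro add_mono "3.IH" ne)
        also have "\<dots> = 2 ^ Suc (2 * M - Suc (length x + length y))" by simp
        also have "\<dots> = 2 ^ (2 * N - length (a # x) - length (b # y))"
          using True N by (auto intro!: arg_cong[where f = "\<lambda>i. 2 ^ i"] simp flip: power_Suc)
        finally show ?thesis .
      qed
    qed
  qed
qed

text \<open>Inside a common prefix the heads always agree, so no branching occurs there.\<close>

lemma min_supseqs_append:
  "min_supseqs (z @ x) (z @ y) = (@) z ` min_supseqs x y"
  by (induction z) (auto simp: image_image)

section \<open>The size of a single insertion ball\<close>

lemma finite_seqs: "finite \<Sigma> \<Longrightarrow> finite (seqs \<Sigma> n)"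
  unfolding seqs_def by (rule finite_lists_length_eq)

lemma card_seqs: "finite \<Sigma> \<Longrightarrow> card (seqs \<Sigma> n) = card \<Sigma> ^ n"
  unfolding seqs_def by (rule card_lists_length_eq)

lemma finite_insertion_ball: "finite \<Sigma> \<Longrightarrow> finite (insertion_ball \<Sigma> t x)"
  unfolding insertion_ball_def by (simp add: finite_seqs)

text \<open>The classical size of a \<open>k\<close>-insertion ball around a word of length
  \<open>N\<close> over \<open>q\<close> letters; it depends on the word only through
  \<open>N\<close>.\<close>

definition ball_size :: "nat \<Rightarrow> nat \<Rightarrow> nat \<Rightarrow> nat" where
  "ball_size q N k = (\<Sum>i\<le>k. ((N + k) choose i) * (q - 1) ^ i)"

lemma ball_size_0: "ball_size q N 0 = 1"
  by (simp add: ball_size_def)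

text \<open>Pascal's rule in every summand except \<open>i = 0\<close>. The recurrence mirrors the
  splitting of a ball by first letter in \<open>insertion_ball_Cons_Suc\<close>.\<close>

lemma ball_size_Suc:
  "ball_size q (Suc N) (Suc k) = ball_size q N (Suc k) + (q - 1) * ball_size q (Suc N) k"
proof -
  have "ball_size q (Suc N) (Suc k)
      = 1 + (\<Sum>i\<le>k. (Suc (N + Suc k) choose Suc i) * (q - 1) ^ Suc i)"
    unfolding ball_size_def sum.atMost_Suc_shift by simp
  also have "\<dots> = (1 + (\<Sum>i\<le>k. ((N + Suc k) choose Suc i) * (q - 1) ^ Suc i))
      + (\<Sum>i\<le>k. ((N + Suc k) choose i) * (q - 1) ^ Suc i)"
  proof -
    have "(Suc M choose Suc i) * r = (M choose i) * r + (M choose Suc i) * r" for M i r :: nat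
      by (simp add: distrib_right)
    then show ?thesis by (simp only: sum.distrib add_ac)
  qed
  also have "1 + (\<Sum>i\<le>k. ((N + Suc k) choose Suc i) * (q - 1) ^ Suc i) = ball_size q N (Suc k)"
    unfolding ball_size_def sum.atMost_Suc_shift by simp
  also have "(\<Sum>i\<le>k. ((N + Suc k) choose i) * (q - 1) ^ Suc i) = (q - 1) * ball_size q (Suc N) k"
    unfolding ball_size_def by (simp add: sum_distrib_left mult_ac)
  finally show ?thesis .
qed

text \<open>The binomial theorem for \<open>(q - 1) + 1\<close>; \<open>q \<ge> 1\<close> keeps the
  subtraction from being truncated.\<close>

lemma ball_size_empty:
  assumes "q \<ge> 1"
  shows "ball_size q 0 k = q ^ k"
proof -
  have "q ^ k = ((q - 1) + 1) ^ k" using assms by simp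
  also have "\<dots> = ball_size q 0 k"
    unfolding binomial_ring ball_size_def by (simp add: mult_ac)
  finally show ?thesis by simp
qed

lemma insertion_ball_0:
  "set x \<subseteq> \<Sigma> \<Longrightarrow> insertion_ball \<Sigma> 0 x = {x}"
  by (auto simp: insertion_ball_def seqs_def dest: subseq_same_length)

text \<open>A first letter \<open>a\<close> may be matched with the head, which leaves all
  insertions for \<open>x\<close>; any other first letter must itself be inserted, which uses up
  one.\<close>

lemma insertion_ball_Cons_Suc:
  assumes "a \<in> \<Sigma>"
  shows "insertion_ball \<Sigma> (Suc k) (a # x) = (#) a ` insertion_ball \<Sigma> (Suc k) x
    \<union> (\<lambda>(c, w). c # w) ` ((\<Sigma> - {a}) \<times> insertion_ball \<Sigma> k (a # x))" (is "?L = ?R")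
proof
  show "?L \<subseteq> ?R"
  proof
    fix w assume w: "w \<in> ?L"
    then obtain c w' where "w = c # w'"
      by (cases w) (auto simp: insertion_ball_def seqs_def)
    with w show "w \<in> ?R"
      by (cases "c = a") (auto simp: insertion_ball_def seqs_def image_iff subseq_Cons2_iff)
  qed
  show "?R \<subseteq> ?L" using assms by (auto simp: insertion_ball_def seqs_def)
qed

lemma card_insertion_ball:
  assumes "finite \<Sigma>" "card \<Sigma> \<ge> 1" "set x \<subseteq> \<Sigma>"
  shows "card (insertion_ball \<Sigma> k x) = ball_size (card \<Sigma>) (length x) k"
  using assms(3)
proof (induction x arbitrary: k)
  case Nil
  have "insertion_ball \<Sigma> k [] = seqs \<Sigma> k" by (simp add: insertion_ball_def)
  then show ?case using assms by (simp add: card_seqs ball_size_empty)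
next
  case (Cons a x)
  note outer = Cons
  show ?case
  proof (induction k)
    case 0
    then show ?case using insertion_ball_0[OF outer(2)] by (simp add: ball_size_0)
  next
    case (Suc k)
    let ?A = "(#) a ` insertion_ball \<Sigma> (Suc k) x"
    let ?B = "(\<lambda>(c, w). c # w) ` ((\<Sigma> - {a}) \<times> insertion_ball \<Sigma> k (a # x))"
    have a: "a \<in> \<Sigma>" using outer(2) by simp
    have "card (insertion_ball \<Sigma> (Suc k) (a # x)) = card ?A + card ?B"
      unfolding insertion_ball_Cons_Suc[OF a]
      by (rule card_Un_disjoint) (use assms in \<open>auto simp: finite_insertion_ball\<close>)
    also have "card ?A = ball_size (card \<Sigma>) (length x) (Suc k)"
      using outer by (simp add: card_image)
    also have "card ?B = (card \<Sigma> - 1) * ball_size (card \<Sigma>) (Suc (length x)) k"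
      using Suc a assms(1)
      by (subst card_image) (auto simp: inj_on_def card_cartesian_product)
    finally show ?case by (simp add: ball_size_Suc)
  qed
qed

section \<open>Covering the intersection of two insertion balls\<close>

abbreviation (input) common_ball :: "'a set \<Rightarrow> nat \<Rightarrow> 'a list \<Rightarrow> 'a list \<Rightarrow> 'a list set" where
  "common_ball \<Sigma> t x y \<equiv> insertion_ball \<Sigma> t x \<inter> insertion_ball \<Sigma> t y"

lemma min_supseqs_in_common_ball:
  assumes "x \<in> seqs \<Sigma> n" "y \<in> seqs \<Sigma> n" "w \<in> min_supseqs x y" "length w = n + j"
  shows "w \<in> common_ball \<Sigma> j x y"
  using assms subseq_min_supseqs[OF assms(3)] set_min_supseqs[OF assms(3)]
  by (auto simp: insertion_ball_def seqs_def)

lemma insertion_ball_subset_common_ball: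
  assumes "x \<in> seqs \<Sigma> n" "y \<in> seqs \<Sigma> n" "w \<in> common_ball \<Sigma> s x y"
  shows "insertion_ball \<Sigma> k w \<subseteq> common_ball \<Sigma> (s + k) x y"
  using assms by (auto simp: insertion_ball_def seqs_def intro: subseq_order.trans)

text \<open>A common supersequence can be padded to any greater length. Thus emptiness at
  \<open>s - 1\<close>, as feasibility provides it, extends to all \<open>j < s\<close>.\<close>

lemma common_ball_empty_antimono:
  assumes "\<Sigma> \<noteq> {}" "x \<in> seqs \<Sigma> n" "y \<in> seqs \<Sigma> n" "common_ball \<Sigma> s x y = {}" "j \<le> s"
  shows "common_ball \<Sigma> j x y = {}"
proof (rule ccontr)
  assume "common_ball \<Sigma> j x y \<noteq> {}"
  then obtain w where w: "w \<in> common_ball \<Sigma> j x y" by blast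
  obtain a where "a \<in> \<Sigma>" using assms(1) by blast
  with w have "w @ replicate (s - j) a \<in> insertion_ball \<Sigma> (s - j) w"
    by (auto simp: insertion_ball_def seqs_def)
  with insertion_ball_subset_common_ball[OF assms(2,3) w, of "s - j"] assms(4,5) show False
    by auto
qed

text \<open>Every common supersequence contains a merge, and \<open>j\<close> is the excess of that
  merge's length over \<open>n\<close>; the remaining \<open>t - j\<close> letters are free
  insertions.\<close>

lemma common_ball_eq_UN:
  assumes "x \<in> seqs \<Sigma> n" "y \<in> seqs \<Sigma> n"
  shows "common_ball \<Sigma> t x y
    = (\<Union>j\<in>{..t}. \<Union>w\<in>{w \<in> min_supseqs x y. length w = n + j}. insertion_ball \<Sigma> (t - j) w)"
    (is "?L = ?R")
proof
  show "?L \<subseteq> ?R"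
  proof
    fix w assume w: "w \<in> ?L"
    then obtain w0 where w0: "w0 \<in> min_supseqs x y" "subseq w0 w"
      using common_supseq_contains_min_supseq[of x w y] by (auto simp: insertion_ball_def)
    have le: "n \<le> length w0" "length w0 \<le> n + t"
      using list_emb_length[of "(=)" x w0] subseq_min_supseqs[OF w0(1)] list_emb_length[OF w0(2)]
        assms w by (auto simp: insertion_ball_def seqs_def)
    have "w \<in> insertion_ball \<Sigma> (t - (length w0 - n)) w0"
      using w w0 le assms by (auto simp: insertion_ball_def seqs_def)
    with w0 le show "w \<in> ?R" by (auto intro!: bexI[of _ "length w0 - n"] exI[of _ w0])
  qed
  show "?R \<subseteq> ?L"
  proof safe
    fix j w v assume *: "j \<le> t" "w \<in> min_supseqs x y" "length w = n + j"
      "v \<in> insertion_ball \<Sigma> (t - j) w"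
    from insertion_ball_subset_common_ball[OF assms min_supseqs_in_common_ball[OF assms *(2,3)],
      of "t - j"] * 
    show "v \<in> insertion_ball \<Sigma> t x" "v \<in> insertion_ball \<Sigma> t y" by auto
  qed
qed

lemma card_common_ball_le:
  assumes "finite \<Sigma>" "card \<Sigma> \<ge> 1" "x \<in> seqs \<Sigma> n" "y \<in> seqs \<Sigma> n"
  shows "card (common_ball \<Sigma> t x y)
    \<le> (\<Sum>j\<le>t. card {w \<in> min_supseqs x y. length w = n + j} * ball_size (card \<Sigma>) (n + j) (t - j))"
proof -
  let ?S = "\<lambda>j. {w \<in> min_supseqs x y. length w = n + j}"
  have "card (common_ball \<Sigma> t x y)
      \<le> (\<Sum>j\<le>t. card (\<Union>w\<in>?S j. insertion_ball \<Sigma> (t - j) w))"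
    unfolding common_ball_eq_UN[OF assms(3,4)] by (rule card_UN_le) simp
  also have "\<dots> \<le> (\<Sum>j\<le>t. \<Sum>w\<in>?S j. card (insertion_ball \<Sigma> (t - j) w))"
    by (intro sum_mono card_UN_le) (simp add: finite_min_supseqs)
  also have "\<dots> = (\<Sum>j\<le>t. \<Sum>w\<in>?S j. ball_size (card \<Sigma>) (n + j) (t - j))"
  proof (intro sum.cong refl)
    fix j w assume "w \<in> ?S j"
    moreover from this have "set w \<subseteq> \<Sigma>"
      using set_min_supseqs[of w x y] assms by (auto simp: seqs_def)
    ultimately show "card (insertion_ball \<Sigma> (t - j) w) = ball_size (card \<Sigma>) (n + j) (t - j)"
      using card_insertion_ball[OF assms(1,2)] by simp
  qed
  finally show ?thesis by simp
qed

text \<open>Merges of excess below \<open>s\<close> do not exist, those of excess \<open>s\<close>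
  lie in the intersection of the \<open>s\<close>-balls, and for larger excess a bound on their
  number free of \<open>n\<close> suffices, as their balls have smaller radius.\<close>

lemma card_common_ball_le_of_empty:
  assumes "finite \<Sigma>" "card \<Sigma> \<ge> 1" "x \<in> seqs \<Sigma> n" "y \<in> seqs \<Sigma> n"
    and "s \<le> t" "\<And>j. j < s \<Longrightarrow> common_ball \<Sigma> j x y = {}"
  shows "card (common_ball \<Sigma> t x y)
    \<le> card (common_ball \<Sigma> s x y) * ball_size (card \<Sigma>) (n + s) (t - s)
      + (\<Sum>j\<in>{s<..t}. 4 ^ j * ball_size (card \<Sigma>) (n + j) (t - j))"
proof -
  let ?c = "\<lambda>j. card {w \<in> min_supseqs x y. length w = n + j}"
  let ?b = "\<lambda>j. ball_size (card \<Sigma>) (n + j) (t - j)"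
  have empty: "?c j = 0" if "j < s" for j
  proof -
    have "{w \<in> min_supseqs x y. length w = n + j} = {}"
      using min_supseqs_in_common_ball[OF assms(3,4)] assms(6)[OF that] by blast
    then show ?thesis by (simp only: card.empty)
  qed
  have cs: "?c s \<le> card (common_ball \<Sigma> s x y)"
    using min_supseqs_in_common_ball[OF assms(3,4)]
    by (intro card_mono) (auto simp: finite_insertion_ball assms)
  \<comment> \<open>Here the exponent is \<open>2 * (n + j) - n - n = 2 * j\<close>, so
    \<open>n\<close> cancels.\<close>
  have c4: "?c j \<le> 4 ^ j" for j
    using card_min_supseqs_le[of x y "n + j"] assms(3,4)
    by (simp add: seqs_def power_mult)
  have "card (common_ball \<Sigma> t x y) \<le> (\<Sum>j\<le>t. ?c j * ?b j)"
    using card_common_ball_le[OF assms(1-4)] .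
  also have "\<dots> = (\<Sum>j\<in>{s..t}. ?c j * ?b j)"
    by (rule sum.mono_neutral_right) (auto simp: empty)
  also have "\<dots> = ?c s * ?b s + (\<Sum>j\<in>{s<..t}. ?c j * ?b j)"
    using assms(5) by (simp add: sum.head)
  also have "\<dots> \<le> card (common_ball \<Sigma> s x y) * ?b s + (\<Sum>j\<in>{s<..t}. 4 ^ j * ?b j)"
    by (intro add_mono sum_mono mult_right_mono cs c4) auto
  finally show ?thesis .
qed

text \<open>If already the \<open>(s - 1)\<close>-balls met, the intersection of the \<open>s\<close>-balls would contain a
  1-insertion ball, which has more than \<open>n\<close> elements.\<close>
lemma card_common_ball_upper:
  assumes "finite \<Sigma>" "card \<Sigma> \<ge> 2" "x \<in> seqs \<Sigma> n" "y \<in> seqs \<Sigma> n"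
    and "1 \<le> s" "s \<le> t" "m \<le> n" "card (common_ball \<Sigma> s x y) \<le> m"
  shows "card (common_ball \<Sigma> t x y)
    \<le> m * ball_size (card \<Sigma>) (n + s) (t - s)
      + (\<Sum>j\<in>{s<..t}. 4 ^ j * ball_size (card \<Sigma>) (n + j) (t - j))"
proof -
  have "common_ball \<Sigma> (s - 1) x y = {}"
  proof (rule ccontr)
    assume "common_ball \<Sigma> (s - 1) x y \<noteq> {}"
    then obtain w where w: "w \<in> common_ball \<Sigma> (s - 1) x y" by blast
    then have "length w = n + (s - 1)" "set w \<subseteq> \<Sigma>"
      using assms(3) by (auto simp: insertion_ball_def seqs_def)
    \<comment> \<open>The centre has length \<open>n + (s - 1)\<close>, and \<open>s \<ge> 1\<close>
      turns the upper binomial index into \<open>n + s\<close>. With at least two letters the size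
      then exceeds \<open>n \<ge> m\<close>.\<close>
    then have "card (insertion_ball \<Sigma> 1 w) = 1 + (n + s) * (card \<Sigma> - 1)"
      using card_insertion_ball[of \<Sigma> w 1] assms by (simp add: ball_size_def)
    moreover have "card (insertion_ball \<Sigma> 1 w) \<le> card (common_ball \<Sigma> s x y)"
      using insertion_ball_subset_common_ball[OF assms(3,4) w, of 1] assms
      by (intro card_mono) (auto simp: finite_insertion_ball)
    moreover have "n + s \<le> (n + s) * (card \<Sigma> - 1)"
    proof -
      have "card \<Sigma> - 1 = Suc (card \<Sigma> - 2)" using assms(2) by simp
      then show ?thesis by simp
    qed
    ultimately show False using assms(7,8) by linarith
  qed
  moreover have "\<Sigma> \<noteq> {}" using assms(2) by auto
  ultimately have "common_ball \<Sigma> j x y = {}" if "j < s" for j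
    using common_ball_empty_antimono[OF _ assms(3,4), of "s - 1" j] that by simp
  then have "card (common_ball \<Sigma> t x y)
    \<le> card (common_ball \<Sigma> s x y) * ball_size (card \<Sigma>) (n + s) (t - s)
      + (\<Sum>j\<in>{s<..t}. 4 ^ j * ball_size (card \<Sigma>) (n + j) (t - j))"
    using assms by (intro card_common_ball_le_of_empty) auto
  also have "\<dots> \<le> m * ball_size (card \<Sigma>) (n + s) (t - s)
      + (\<Sum>j\<in>{s<..t}. 4 ^ j * ball_size (card \<Sigma>) (n + j) (t - j))"
    using assms(8) by (intro add_right_mono mult_right_mono) auto
  finally show ?thesis .
qed

section \<open>Lower bound: common prefixes and overlaps of balls\<close>

text \<open>Merges of the prefixed words are prefixed merges. Emptiness below \<open>s\<close>
  leaves only those of excess exactly \<open>s\<close>, so the covering balls have radius 0 and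
  contribute only their centres.\<close>

lemma common_ball_append:
  assumes "\<Sigma> \<noteq> {}" "z \<in> seqs \<Sigma> l" "u \<in> seqs \<Sigma> L" "v \<in> seqs \<Sigma> L"
    and "\<And>j. j < s \<Longrightarrow> common_ball \<Sigma> j u v = {}"
  shows "common_ball \<Sigma> s (z @ u) (z @ v) = (@) z ` common_ball \<Sigma> s u v"
proof
  have zu: "z @ u \<in> seqs \<Sigma> (l + L)" "z @ v \<in> seqs \<Sigma> (l + L)"
    using assms by (auto simp: seqs_def)
  show "common_ball \<Sigma> s (z @ u) (z @ v) \<subseteq> (@) z ` common_ball \<Sigma> s u v"
  proof
    fix w assume "w \<in> common_ball \<Sigma> s (z @ u) (z @ v)"
    then obtain j w0 where j: "j \<le> s" and w0: "w0 \<in> min_supseqs u v"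
      and len: "length (z @ w0) = l + L + j" and w: "w \<in> insertion_ball \<Sigma> (s - j) (z @ w0)"
      unfolding common_ball_eq_UN[OF zu] min_supseqs_append by auto
    have "w0 \<in> common_ball \<Sigma> j u v"
      using len assms(2) by (intro min_supseqs_in_common_ball[OF assms(3,4) w0]) (auto simp: seqs_def)
    with assms(5) j have "j = s" using le_neq_implies_less by blast
    moreover have "set (z @ w0) \<subseteq> \<Sigma>"
      using \<open>w0 \<in> common_ball \<Sigma> j u v\<close> assms(2) by (auto simp: insertion_ball_def seqs_def)
    ultimately have "w = z @ w0" using w insertion_ball_0[of "z @ w0" \<Sigma>] by simp
    with \<open>w0 \<in> common_ball \<Sigma> j u v\<close> \<open>j = s\<close>
    show "w \<in> (@) z ` common_ball \<Sigma> s u v" by blast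
  qed
  show "(@) z ` common_ball \<Sigma> s u v \<subseteq> common_ball \<Sigma> s (z @ u) (z @ v)"
    using assms(2) by (auto simp: insertion_ball_def seqs_def subseq_append')
qed

text \<open>A Bonferroni inequality with one bound \<open>c\<close> for all overlaps; the number of
  pairs is estimated by the square of \<open>card W\<close>.\<close>

lemma card_UN_ge:
  assumes "finite W" "\<And>w. w \<in> W \<Longrightarrow> finite (A w)"
    and "\<And>w w'. w \<in> W \<Longrightarrow> w' \<in> W \<Longrightarrow> w \<noteq> w' \<Longrightarrow> card (A w \<inter> A w') \<le> c"
  shows "(\<Sum>w\<in>W. card (A w)) \<le> card (\<Union>w\<in>W. A w) + card W * card W * c"
  using assms
proof (induction W rule: finite_induct)
  case (insert w W)
  have "A w \<inter> (\<Union>w\<in>W. A w) = (\<Union>w'\<in>W. A w \<inter> A w')" by blast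
  then have "card (A w \<inter> (\<Union>w\<in>W. A w)) \<le> (\<Sum>w'\<in>W. card (A w \<inter> A w'))"
    using card_UN_le[OF insert.hyps(1)] by metis
  also have "\<dots> \<le> card W * c"
    using insert.hyps insert.prems(2) by (intro sum_bounded_above[where K = c, simplified]) auto
  finally have inter: "card (A w \<inter> (\<Union>w\<in>W. A w)) \<le> card W * c" .
  have "card (A w) + card (\<Union>w\<in>W. A w)
      = card (\<Union>w\<in>insert w W. A w) + card (A w \<inter> (\<Union>w\<in>W. A w))"
    using card_Un_Int[of "A w" "\<Union>w\<in>W. A w"] insert.hyps insert.prems(1) by simp
  moreover have "(\<Sum>w\<in>W. card (A w)) \<le> card (\<Union>w\<in>W. A w) + card W * card W * c"
    using insert.prems by (intro insert.IH) auto
  \<comment> \<open>This rests on \<open>k * k + k \<le> (k + 1) * (k + 1)\<close> for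
    \<open>k = card W\<close>.\<close>
  ultimately show ?case using inter insert.hyps by (simp add: algebra_simps)
qed simp

lemma card_common_ball_lower:
  assumes "finite \<Sigma>" "card \<Sigma> \<ge> 1" "x \<in> seqs \<Sigma> n" "y \<in> seqs \<Sigma> n"
    and "s \<le> t" "card (common_ball \<Sigma> s x y) = m"
  shows "m * ball_size (card \<Sigma>) (n + s) (t - s)
    \<le> card (common_ball \<Sigma> t x y)
      + m * m * (\<Sum>j\<in>{0<..t - s}. 4 ^ j * ball_size (card \<Sigma>) (n + s + j) (t - s - j))"
    (is "_ \<le> _ + _ * ?c")
proof -
  let ?W = "common_ball \<Sigma> s x y"
  let ?A = "insertion_ball \<Sigma> (t - s)"
  have W: "w \<in> seqs \<Sigma> (n + s)" if "w \<in> ?W" for w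
    using that assms(3) by (auto simp: insertion_ball_def seqs_def)
  have "card (?A w \<inter> ?A w') \<le> ?c" if "w \<in> ?W" "w' \<in> ?W" "w \<noteq> w'" for w w'
  proof -
    \<comment> \<open>Disjoint 0-balls make the leading term vanish in the covering bound at level
      0, so the overlap is bounded by balls of radius below \<open>t - s\<close>.\<close>
    have "common_ball \<Sigma> 0 w w' = {}"
      using W[OF that(1)] W[OF that(2)] that(3) insertion_ball_0[of _ \<Sigma>] by (auto simp: seqs_def)
    then show ?thesis
      using card_common_ball_le_of_empty[OF assms(1,2) W[OF that(1)] W[OF that(2)], of 0 "t - s"]
      by simp
  qed
  then have "(\<Sum>w\<in>?W. card (?A w)) \<le> card (\<Union>w\<in>?W. ?A w) + card ?W * card ?W * ?c"
    using assms(1) by (intro card_UN_ge) (auto simp: finite_insertion_ball)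
  also have "card (\<Union>w\<in>?W. ?A w) \<le> card (common_ball \<Sigma> t x y)"
  proof (rule card_mono)
    show "finite (common_ball \<Sigma> t x y)" using assms(1) by (simp add: finite_insertion_ball)
    show "(\<Union>w\<in>?W. ?A w) \<subseteq> common_ball \<Sigma> t x y"
      using insertion_ball_subset_common_ball[OF assms(3,4), of _ s "t - s"] assms(5)
      by (intro UN_least) simp
  qed
  also have "(\<Sum>w\<in>?W. card (?A w)) = (\<Sum>w\<in>?W. ball_size (card \<Sigma>) (n + s) (t - s))"
    using W assms by (intro sum.cong refl, subst card_insertion_ball) (auto simp: seqs_def)
  finally show ?thesis using assms(6) by simp
qed

section \<open>Asymptotics of ball sizes\<close>

text \<open>Integer exponents serve the case \<open>s = t\<close>, where the error term is of order
  \<open>n\<close> to the power -1.\<close>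

lemma powi_bigo_powi:
  "a \<le> b \<Longrightarrow> (\<lambda>n. real n powi a) \<in> O(\<lambda>n. real n powi b)"
  by (intro bigoI[where c = 1] eventually_sequentiallyI[of 1])
    (simp add: power_int_increasing)

lemma power_bigo_powi:
  "int i \<le> b \<Longrightarrow> (\<lambda>n. real n ^ i) \<in> O(\<lambda>n. real n powi b)"
  using powi_bigo_powi[of "int i" b] by simp

lemma bigo_power_of_leading_term:
  assumes "(\<lambda>n. f n - c * real n ^ k) \<in> O(\<lambda>n. real n powi (int k - 1))"
  shows "f \<in> O(\<lambda>n. real n ^ k)"
proof -
  have "(\<lambda>n. real n powi (int k - 1)) \<in> O(\<lambda>n. real n ^ k)"
    using powi_bigo_powi[of "int k - 1" "int k"] by simp
  then have "(\<lambda>n. f n - c * real n ^ k) \<in> O(\<lambda>n. real n ^ k)"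
    using assms landau_o.big_trans by blast
  from sum_in_bigo(1)[OF this, of "\<lambda>n. c * real n ^ k"] show ?thesis by simp
qed

text \<open>Induction by \<open>(k + 1) * (N choose (k + 1)) = (N choose k) * (N - k)\<close> with
  \<open>N = n + c\<close>: the factor \<open>n\<close> raises the order of the error by one, and
  the constant part of \<open>N - k\<close> only adds terms of order \<open>n^k\<close>.\<close>

lemma binomial_asymp:
  "(\<lambda>n. real ((n + c) choose k) - 1 / fact k * real n ^ k) \<in> O(\<lambda>n. real n powi (int k - 1))"
proof (induction k)
  case 0
  then show ?case by simp
next
  case (Suc k)
  let ?f = "\<lambda>n. real ((n + c) choose k)"
  have eq: "real ((n + c) choose Suc k) - 1 / fact (Suc k) * real n ^ Suc k
      = 1 / real (Suc k) * ((?f n - 1 / fact k * real n ^ k) * real n + (real c - real k) * ?f n)" for n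
  proof -
    have "real (Suc k) * real ((n + c) choose Suc k) = ?f n * (real n + real c - real k)"
    proof (cases "k \<le> n + c")
      case True
      have "Suc k * ((n + c) choose Suc k) = ((n + c) choose k) * (n + c - k)"
        by (metis binomial_absorb_comp binomial_absorption mult.commute Suc_diff_Suc diff_Suc_1)
      then have "real (Suc k * ((n + c) choose Suc k)) = real (((n + c) choose k) * (n + c - k))"
        by (simp only:)
      then show ?thesis using True by (simp add: of_nat_diff distrib_right)
    next
      case False
      then show ?thesis by (simp add: binomial_eq_0)
    qed
    then have "real ((n + c) choose Suc k) = ?f n * (real n + real c - real k) / real (Suc k)"
      by (simp add: eq_divide_eq mult.commute del: of_nat_Suc)
    moreover have "b * (x + y - z) / d - 1 / (d * e) * (x * p)
        = 1 / d * ((b - 1 / e * p) * x + (y - z) * b)" if "d \<noteq> 0" "e \<noteq> 0" for b x y z d e p :: real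
      using that by (simp add: field_simps)
    ultimately show ?thesis by (simp only: fact_Suc power_Suc) simp
  qed
  \<comment> \<open>The two functions agree for \<open>n \<ge> 1\<close>; for \<open>k = 0\<close>
    they differ at \<open>n = 0\<close>.\<close>
  have "(\<lambda>n. real n powi (int k - 1) * real n) \<in> O(\<lambda>n. real n powi int k)"
    by (intro bigoI[where c = 1] eventually_sequentiallyI[of 1])
      (simp add: power_int_diff)
  then have "(\<lambda>n. (?f n - 1 / fact k * real n ^ k) * real n) \<in> O(\<lambda>n. real n powi int k)"
    using landau_o.big.mult[OF Suc landau_o.big_refl[of real]] landau_o.big_trans by blast
  moreover have "(\<lambda>n. (real c - real k) * ?f n) \<in> O(\<lambda>n. real n powi int k)"
    using bigo_power_of_leading_term[OF Suc] by simp
  ultimately show ?case unfolding eq by (simp add: sum_in_bigo)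
qed

text \<open>Only the summand \<open>i = k\<close> reaches order \<open>n^k\<close>; the others fall
  into the error term.\<close>

lemma ball_size_asymp:
  assumes "q \<ge> 1"
  shows "(\<lambda>n. real (ball_size q (n + a) k) - (real q - 1) ^ k / fact k * real n ^ k)
    \<in> O(\<lambda>n. real n powi (int k - 1))"
proof -
  have eq: "real (ball_size q (n + a) k) - (real q - 1) ^ k / fact k * real n ^ k
     = (\<Sum>i<k. real ((n + (a + k)) choose i) * (real q - 1) ^ i)
       + (real q - 1) ^ k * (real ((n + (a + k)) choose k) - 1 / fact k * real n ^ k)" for n
    using assms unfolding ball_size_def lessThan_Suc_atMost[symmetric]
    by (simp add: of_nat_diff algebra_simps)
  have "(\<lambda>n. real ((n + (a + k)) choose i) * (real q - 1) ^ i) \<in> O(\<lambda>n. real n powi (int k - 1))"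
    if "i < k" for i
    using landau_o.big_trans[OF bigo_power_of_leading_term[OF binomial_asymp]
        power_bigo_powi[of i "int k - 1"]] that by simp
  then have "(\<lambda>n. \<Sum>i<k. real ((n + (a + k)) choose i) * (real q - 1) ^ i)
      \<in> O(\<lambda>n. real n powi (int k - 1))"
    by (intro big_sum_in_bigo) simp
  moreover have "(\<lambda>n. (real q - 1) ^ k * (real ((n + (a + k)) choose k) - 1 / fact k * real n ^ k))
      \<in> O(\<lambda>n. real n powi (int k - 1))"
    using binomial_asymp[of "a + k" k] by simp
  ultimately show ?thesis unfolding eq by (rule sum_in_bigo(1))
qed

text \<open>Each \<open>j > s\<close> has radius \<open>t - j \<le> t - s - 1\<close>. The shift
  \<open>g\<close> covers both uses: centres of length \<open>n + j\<close> in the upper bound and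
  \<open>n + (s + j)\<close> in the overlaps.\<close>

lemma ball_size_sum_bigo:
  assumes "q \<ge> 1"
  shows "(\<lambda>n. \<Sum>j\<in>{s<..t}. 4 ^ j * real (ball_size q (n + g j) (t - j)))
    \<in> O(\<lambda>n. real n powi (int (t - s) - 1))"
proof (intro big_sum_in_bigo)
  fix j assume "j \<in> {s<..t}"
  then have "int (t - j) \<le> int (t - s) - 1" by auto
  from landau_o.big_trans[OF bigo_power_of_leading_term[OF ball_size_asymp[OF assms]]
      power_bigo_powi[OF this]]
  show "(\<lambda>n. 4 ^ j * real (ball_size q (n + g j) (t - j))) \<in> O(\<lambda>n. real n powi (int (t - s) - 1))"
    by simp
qed

section \<open>Squeezing the maximum between the two bounds\<close>

lemma bigo_squeeze:
  fixes f g h :: "nat \<Rightarrow> real"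
  assumes "f \<in> O(k)" "h \<in> O(k)" "\<forall>\<^sub>F n in sequentially. f n \<le> g n \<and> g n \<le> h n"
  shows "g \<in> O(k)"
proof -
  have "(\<lambda>n. \<bar>f n\<bar> + \<bar>h n\<bar>) \<in> O(k)" using assms by (simp add: sum_in_bigo)
  moreover have "g \<in> O(\<lambda>n. \<bar>f n\<bar> + \<bar>h n\<bar>)"
    using assms(3) by (intro bigoI[where c = 1]) (auto elim!: eventually_mono)
  ultimately show ?thesis using landau_o.big_trans by blast
qed

theorem theorem1p12:
  fixes \<Sigma> :: "'a set" and q s t m :: nat
  assumes "finite \<Sigma>" and "card \<Sigma> = q" and "q \<ge> 2"
    and "1 \<le> s" and "s \<le> t"
    and "insertion_feasible \<Sigma> s m"
  shows "(\<lambda>n. real (Max {card (insertion_ball \<Sigma> t x \<inter> insertion_ball \<Sigma> t y) | x y.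
                  x \<in> seqs \<Sigma> n \<and> y \<in> seqs \<Sigma> n \<and>
                  card (insertion_ball \<Sigma> s x \<inter> insertion_ball \<Sigma> s y) \<le> m})
              - real m * (real q - 1) ^ (t - s) / fact (t - s) * real n ^ (t - s))
         \<in> O(\<lambda>n. real n powi (int (t - s) - 1))"
proof -
  define F where "F n = {card (common_ball \<Sigma> t x y) | x y.
    x \<in> seqs \<Sigma> n \<and> y \<in> seqs \<Sigma> n \<and> card (common_ball \<Sigma> s x y) \<le> m}" for n
  define main where "main n = real m * (real q - 1) ^ (t - s) / fact (t - s) * real n ^ (t - s)"
    for n :: nat
  define B where "B n = real (ball_size q (n + s) (t - s))" for n
  \<comment> \<open>\<open>U\<close> bounds the contribution of merges longer than
    \<open>n + s\<close>; \<open>V\<close> bounds the overlap of two \<open>(t - s)\<close>-balls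
    around distinct words of length \<open>n + s\<close>.\<close>
  define U where "U n = (\<Sum>j\<in>{s<..t}. 4 ^ j * real (ball_size q (n + j) (t - j)))" for n
  define V where "V n = (\<Sum>j\<in>{0<..t - s}. 4 ^ j * real (ball_size q (n + (s + j)) (t - s - j)))" for n
  obtain L u v where u: "u \<in> seqs \<Sigma> L" and v: "v \<in> seqs \<Sigma> L"
    and empty: "common_ball \<Sigma> (s - 1) u v = {}" and m: "card (common_ball \<Sigma> s u v) = m"
    using assms(6) unfolding insertion_feasible_def by blast
  have ne: "\<Sigma> \<noteq> {}" using assms by auto
  \<comment> \<open>\<open>Max\<close> is meaningful only for a finite nonempty set; nonemptiness
    will come from \<open>lower\<close>.\<close>
  have fin: "finite (F n)" for n
    by (rule finite_subset[of _ "(\<lambda>(x, y). card (common_ball \<Sigma> t x y)) ` (seqs \<Sigma> n \<times> seqs \<Sigma> n)"])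
      (auto simp: F_def finite_seqs assms(1))
  have upper: "real c \<le> real m * B n + U n" if "c \<in> F n" "m \<le> n" for n c
  proof -
    from that obtain x y where "x \<in> seqs \<Sigma> n" "y \<in> seqs \<Sigma> n"
      "card (common_ball \<Sigma> s x y) \<le> m" "c = card (common_ball \<Sigma> t x y)"
      unfolding F_def by blast
    then have "c \<le> m * ball_size q (n + s) (t - s)
        + (\<Sum>j\<in>{s<..t}. 4 ^ j * ball_size q (n + j) (t - j))"
      using card_common_ball_upper[of \<Sigma> x n y s t m] assms that by simp
    then have "real c \<le> real (m * ball_size q (n + s) (t - s)
        + (\<Sum>j\<in>{s<..t}. 4 ^ j * ball_size q (n + j) (t - j)))" by (rule of_nat_mono)
    then show ?thesis by (simp add: B_def U_def)
  qed
  have lower: "\<exists>c\<in>F n. real m * B n - real m * real m * V n \<le> real c" if "L \<le> n" for n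
  proof -
    obtain a where a: "a \<in> \<Sigma>" using ne by blast
    \<comment> \<open>The prefix pads the feasible pair from length \<open>L\<close> to length
      \<open>n\<close>; any letter would do.\<close>
    define z where "z = replicate (n - L) a"
    have z: "z \<in> seqs \<Sigma> (n - L)" using a by (auto simp: z_def seqs_def)
    have xy: "z @ u \<in> seqs \<Sigma> n" "z @ v \<in> seqs \<Sigma> n" using z u v that by (auto simp: seqs_def)
    have "common_ball \<Sigma> j u v = {}" if "j < s" for j
      using common_ball_empty_antimono[OF ne u v empty] that by simp
    then have card_m: "card (common_ball \<Sigma> s (z @ u) (z @ v)) = m"
      using common_ball_append[OF ne z u v, of s] m by (simp add: card_image inj_on_def)
    have "m * ball_size q (n + s) (t - s) \<le> card (common_ball \<Sigma> t (z @ u) (z @ v))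
        + m * m * (\<Sum>j\<in>{0<..t - s}. 4 ^ j * ball_size q (n + s + j) (t - s - j))"
      using card_common_ball_lower[OF assms(1) _ xy assms(5) card_m] assms by simp
    then have "real (m * ball_size q (n + s) (t - s)) \<le> real (card (common_ball \<Sigma> t (z @ u) (z @ v))
        + m * m * (\<Sum>j\<in>{0<..t - s}. 4 ^ j * ball_size q (n + s + j) (t - s - j)))"
      by (rule of_nat_mono)
    then have "real m * B n - real m * real m * V n
        \<le> real (card (common_ball \<Sigma> t (z @ u) (z @ v)))"
      by (simp add: B_def V_def add.assoc)
    moreover have "card (common_ball \<Sigma> t (z @ u) (z @ v)) \<in> F n"
      unfolding F_def using xy card_m by blast
    ultimately show ?thesis by blast
  qed
  have bounds: "\<forall>\<^sub>F n in sequentially. real m * B n - main n - real m * real m * V n \<le> real (Max (F n)) - main n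
      \<and> real (Max (F n)) - main n \<le> real m * B n - main n + U n"
  \<comment> \<open>\<open>n \<ge> L\<close> leaves room for the prefix, and
    \<open>n \<ge> m\<close> is what the upper bound requires.\<close>
  proof (rule eventually_sequentiallyI[of "max L m"])
    fix n assume n: "max L m \<le> n"
    then obtain c where c: "c \<in> F n" "real m * B n - real m * real m * V n \<le> real c"
      using lower[of n] by auto
    have "Max (F n) \<in> F n" using fin c(1) by (intro Max_in) auto
    then have "real (Max (F n)) \<le> real m * B n + U n" using upper n by auto
    moreover have "real c \<le> real (Max (F n))" using Max_ge[OF fin c(1)] by simp
    ultimately show "real m * B n - main n - real m * real m * V n \<le> real (Max (F n)) - main n
      \<and> real (Max (F n)) - main n \<le> real m * B n - main n + U n" using c(2) by simp
  qed
  have B: "(\<lambda>n. real m * B n - main n) \<in> O(\<lambda>n. real n powi (int (t - s) - 1))"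
  proof -
    have "real m * B n - main n
        = real m * (B n - (real q - 1) ^ (t - s) / fact (t - s) * real n ^ (t - s))" for n
      by (simp add: main_def right_diff_distrib)
    then show ?thesis using ball_size_asymp[of q s "t - s"] assms(3) by (simp add: B_def)
  qed
  have U: "U \<in> O(\<lambda>n. real n powi (int (t - s) - 1))"
    using ball_size_sum_bigo[where q = q and s = s and t = t and g = "\<lambda>j. j"] assms(3) by (simp add: U_def[abs_def])
  have V: "V \<in> O(\<lambda>n. real n powi (int (t - s) - 1))"
    using ball_size_sum_bigo[where q = q and s = 0 and t = "t - s" and g = "\<lambda>j. s + j"] assms(3) by (simp add: V_def[abs_def])
  have "(\<lambda>n. real m * real m * V n) \<in> O(\<lambda>n. real n powi (int (t - s) - 1))"
    using V by simp
  from bigo_squeeze[OF sum_in_bigo(2)[OF B this] sum_in_bigo(1)[OF B U] bounds]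
  show ?thesis unfolding F_def main_def .
qed

end
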